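(* Let $R$ be a noetherian ring, and regard $R$ as a left module over itself. Then the following conditions are equivalent: (i) $R$ is a compressible module; (ii) $R$ is a critically compressible module; (iii) for every nonzero uniform submodule $U$ of $R$ there exists a monomorphism of $R$-modules $R\to U$; (iv) for every nonzero cyclic uniform submodule $U$ of $R$ there exists a monomorphism of $R$-modules $R\to U$.
   Context: Rings are associative with identity $1\neq 0$; modules are unitary left modules; noetherian means left and right noetherian. A nonzero module $M$ is compressible if for every nonzero submodule $N\le M$ there is a monomorphism $M\to N$. A module $M$ is critically compressible if it is compressible and, in addition, there is no monomorphism $M\to M/N$ for any nonzero submodule $N\le M$. A module is uniform if any two nonzero submodules have nonzero intersection. *)

theory Defs
  imports "HOL-Algebra.Module" "HOL-Algebra.QuotRing"
begin

text \<open>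
  The library locale \<^locale>\<open>module\<close> assumes a commutative base ring, so left modules over an
  arbitrary ring are introduced here, on the same record type. As for the library's modules, the
  fields \<^const>\<open>mult\<close> and \<^const>\<open>one\<close> of the record of a module carry no meaning. The library
  predicate \<^locale>\<open>submodule\<close> assumes nothing about the ring and is reused as it is; a submodule
  \<open>N\<close> of \<open>M\<close>, regarded as a module, is \<open>M\<lparr>carrier := N\<rparr>\<close>.
\<close>

locale left_module = R?: ring R + M?: abelian_group M
  for R :: "('a, 'm) ring_scheme" (structure) and M :: "('a, 'b, 'n) module_scheme" (structure) +
  assumes smult_closed [simp, intro]:
      "\<lbrakk>a \<in> carrier R; x \<in> carrier M\<rbrakk> \<Longrightarrow> a \<odot>\<^bsub>M\<^esub> x \<in> carrier M"
    and smult_l_distr: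
      "\<lbrakk>a \<in> carrier R; b \<in> carrier R; x \<in> carrier M\<rbrakk> \<Longrightarrow>
        (a \<oplus>\<^bsub>R\<^esub> b) \<odot>\<^bsub>M\<^esub> x = a \<odot>\<^bsub>M\<^esub> x \<oplus>\<^bsub>M\<^esub> b \<odot>\<^bsub>M\<^esub> x"
    and smult_r_distr:
      "\<lbrakk>a \<in> carrier R; x \<in> carrier M; y \<in> carrier M\<rbrakk> \<Longrightarrow>
        a \<odot>\<^bsub>M\<^esub> (x \<oplus>\<^bsub>M\<^esub> y) = a \<odot>\<^bsub>M\<^esub> x \<oplus>\<^bsub>M\<^esub> a \<odot>\<^bsub>M\<^esub> y"
    and smult_assoc1:
      "\<lbrakk>a \<in> carrier R; b \<in> carrier R; x \<in> carrier M\<rbrakk> \<Longrightarrow>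
        (a \<otimes>\<^bsub>R\<^esub> b) \<odot>\<^bsub>M\<^esub> x = a \<odot>\<^bsub>M\<^esub> (b \<odot>\<^bsub>M\<^esub> x)"
    and smult_one [simp]:
      "x \<in> carrier M \<Longrightarrow> \<one>\<^bsub>R\<^esub> \<odot>\<^bsub>M\<^esub> x = x"

definition module_mono ::
    "('a, 'm) ring_scheme \<Rightarrow> ('a, 'b, 'n) module_scheme \<Rightarrow> ('a, 'c, 'k) module_scheme \<Rightarrow> ('b \<Rightarrow> 'c) set"
  where "module_mono R M N =
    {f. f \<in> carrier M \<rightarrow> carrier N \<and>
        (\<forall>x\<in>carrier M. \<forall>y\<in>carrier M. f (x \<oplus>\<^bsub>M\<^esub> y) = f x \<oplus>\<^bsub>N\<^esub> f y) \<and>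
        (\<forall>r\<in>carrier R. \<forall>x\<in>carrier M. f (r \<odot>\<^bsub>M\<^esub> x) = r \<odot>\<^bsub>N\<^esub> f x) \<and>
        inj_on f (carrier M)}"

text \<open>
  The scalar action on cosets \<open>r (N + x) = N + r x\<close> is written as a union over all
  representatives of the coset, in the style of \<^const>\<open>rcoset_mult\<close>.
\<close>

definition quotient_module :: "('a, 'b, 'n) module_scheme \<Rightarrow> 'b set \<Rightarrow> ('a, 'b set) module"
  where "quotient_module M N =
    \<lparr>carrier = a_rcosets\<^bsub>M\<^esub> N, mult = undefined, one = undefined,
     zero = N, add = set_add M,
     smult = (\<lambda>r X. \<Union>x\<in>X. N +>\<^bsub>M\<^esub> (r \<odot>\<^bsub>M\<^esub> x))\<rparr>"

definition regular_module :: "('a, 'm) ring_scheme \<Rightarrow> ('a, 'a) module"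
  where "regular_module R =
    \<lparr>carrier = carrier R, mult = undefined, one = undefined,
     zero = zero R, add = add R, smult = mult R\<rparr>"

definition opposite_ring :: "('a, 'm) ring_scheme \<Rightarrow> ('a, 'm) ring_scheme"
  where "opposite_ring R = R\<lparr>mult := \<lambda>x y. y \<otimes>\<^bsub>R\<^esub> x\<rparr>"

locale noetherian_module = left_module +
  assumes ascending_chain:
    "\<And>C :: nat \<Rightarrow> 'b set. \<lbrakk>\<And>n. submodule (C n) R M; \<And>n. C n \<subseteq> C (Suc n)\<rbrakk> \<Longrightarrow>
      \<exists>m. \<forall>n\<ge>m. C n = C m"

text \<open>
  Two-sided noetherian rings with \<open>1 \<noteq> 0\<close>. Right ideals of \<open>R\<close> are the submodules of the regular
  left module of the opposite ring. This differs from the locale \<open>noetherian_ring\<close> of HOL-Algebra,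
  which is a condition on two-sided ideals only.
\<close>

locale left_right_noetherian_ring = ring R for R (structure) +
  assumes one_not_zero: "\<one> \<noteq> \<zero>"
    and left_noetherian: "noetherian_module R (regular_module R)"
    and right_noetherian: "noetherian_module (opposite_ring R) (regular_module (opposite_ring R))"

locale compressible_module = left_module +
  assumes nonzero: "carrier M \<noteq> {\<zero>\<^bsub>M\<^esub>}"
    and mono_into_submodule:
      "\<And>N. \<lbrakk>submodule N R M; N \<noteq> {\<zero>\<^bsub>M\<^esub>}\<rbrakk> \<Longrightarrow> \<exists>f. f \<in> module_mono R M (M\<lparr>carrier := N\<rparr>)"

locale critically_compressible_module = compressible_module +
  assumes no_mono_into_quotient:
      "\<And>N. \<lbrakk>submodule N R M; N \<noteq> {\<zero>\<^bsub>M\<^esub>}\<rbrakk> \<Longrightarrow> \<not> (\<exists>f. f \<in> module_mono R M (quotient_module M N))"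

locale uniform_module = left_module +
  assumes nonzero_inter:
      "\<And>A B. \<lbrakk>submodule A R M; submodule B R M; A \<noteq> {\<zero>\<^bsub>M\<^esub>}; B \<noteq> {\<zero>\<^bsub>M\<^esub>}\<rbrakk> \<Longrightarrow> A \<inter> B \<noteq> {\<zero>\<^bsub>M\<^esub>}"

locale cyclic_module = left_module +
  assumes generator: "\<exists>x\<in>carrier M. carrier M = {r \<odot>\<^bsub>M\<^esub> x | r. r \<in> carrier R}"


lemma opposite_ring_ring:
  assumes "ring R"
  shows "ring (opposite_ring R)"
proof -
  interpret ring R by fact
  have "abelian_group (opposite_ring R)"
  proof (rule abelian_groupI)
    fix x assume "x \<in> carrier (opposite_ring R)"
    then show "\<exists>y\<in>carrier (opposite_ring R). y \<oplus>\<^bsub>opposite_ring R\<^esub> x = \<zero>\<^bsub>opposite_ring R\<^esub>"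
      by (intro bexI[of _ "\<ominus>\<^bsub>R\<^esub> x"]) (simp_all add: opposite_ring_def l_neg)
  qed (simp_all add: opposite_ring_def a_ac)
  moreover have "monoid (opposite_ring R)"
    by (rule monoidI) (auto simp: opposite_ring_def m_assoc)
  ultimately show ?thesis
    by (rule ringI) (auto simp: opposite_ring_def l_distr r_distr)
qed

lemma regular_module_left_module:
  assumes "ring R"
  shows "left_module R (regular_module R)"
proof -
  interpret ring R by fact
  have "abelian_group (regular_module R)"
  proof (rule abelian_groupI)
    fix x assume "x \<in> carrier (regular_module R)"
    then show "\<exists>y\<in>carrier (regular_module R). y \<oplus>\<^bsub>regular_module R\<^esub> x = \<zero>\<^bsub>regular_module R\<^esub>"
      by (intro bexI[of _ "\<ominus>\<^bsub>R\<^esub> x"]) (simp_all add: regular_module_def l_neg)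
  qed (simp_all add: regular_module_def a_ac)
  then show ?thesis
    by (intro left_module.intro left_module_axioms.intro assms)
      (auto simp: regular_module_def m_assoc l_distr r_distr)
qed

lemma (in left_module) submodule_left_module:
  assumes "submodule N R M"
  shows "left_module R (M\<lparr>carrier := N\<rparr>)"
proof -
  interpret N: submodule N R M by fact
  have sub: "x \<in> carrier M" if "x \<in> N" for x
    using N.subset that by auto
  have neg: "\<ominus>\<^bsub>M\<^esub> x \<in> N" if "x \<in> N" for x
    using N.m_inv_closed[OF that] by (simp add: a_inv_def)
  have closed: "x \<oplus>\<^bsub>M\<^esub> y \<in> N" if "x \<in> N" "y \<in> N" for x y
    using N.m_closed[OF that] by simp
  have zero: "\<zero>\<^bsub>M\<^esub> \<in> N"
    using N.one_closed by simp
  have "abelian_group (M\<lparr>carrier := N\<rparr>)"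
    by (rule abelian_groupI)
      (simp_all add: sub closed zero M.a_ac, blast intro: M.r_neg neg sub)
  then show ?thesis
    by (intro left_module.intro left_module_axioms.intro R.ring_axioms)
      (auto simp: sub N.smult_closed smult_l_distr smult_r_distr smult_assoc1)
qed

lemma (in left_module) quotient_smult:
  assumes "submodule N R M" "r \<in> carrier R" "x \<in> carrier M"
  shows "r \<odot>\<^bsub>quotient_module M N\<^esub> (N +>\<^bsub>M\<^esub> x) = N +>\<^bsub>M\<^esub> (r \<odot>\<^bsub>M\<^esub> x)"
proof -
  interpret N: submodule N R M by fact
  have sg: "subgroup N (add_monoid M)" by (rule N.subgroup_axioms)
  have sub: "n \<in> carrier M" if "n \<in> N" for n
    using N.subset that by auto
  have eq: "N +>\<^bsub>M\<^esub> (r \<odot>\<^bsub>M\<^esub> y) = N +>\<^bsub>M\<^esub> (r \<odot>\<^bsub>M\<^esub> x)" if y: "y \<in> N +>\<^bsub>M\<^esub> x" for y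
  proof -
    obtain n where n: "n \<in> N" "y = n \<oplus>\<^bsub>M\<^esub> x"
      using y by (auto simp: a_r_coset_def')
    then have "r \<odot>\<^bsub>M\<^esub> y = r \<odot>\<^bsub>M\<^esub> n \<oplus>\<^bsub>M\<^esub> r \<odot>\<^bsub>M\<^esub> x"
      using assms sub by (simp add: smult_r_distr)
    then have "r \<odot>\<^bsub>M\<^esub> y \<in> N +>\<^bsub>M\<^esub> (r \<odot>\<^bsub>M\<^esub> x)"
      using n(1) assms(2) N.smult_closed by (auto simp: a_r_coset_def')
    then show ?thesis
      using M.add.repr_independence[OF _ _ sg, of "r \<odot>\<^bsub>M\<^esub> y" "r \<odot>\<^bsub>M\<^esub> x"] assms
      by (simp add: a_r_coset_def)
  qed
  have "x \<in> N +>\<^bsub>M\<^esub> x"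
    using M.add.rcos_self[OF _ sg] assms by (simp add: a_r_coset_def)
  then have "(\<Union>y\<in>N +>\<^bsub>M\<^esub> x. N +>\<^bsub>M\<^esub> (r \<odot>\<^bsub>M\<^esub> y)) = N +>\<^bsub>M\<^esub> (r \<odot>\<^bsub>M\<^esub> x)"
    using eq by blast
  then show ?thesis
    by (simp add: quotient_module_def)
qed

lemma (in left_module) quotient_left_module:
  assumes "submodule N R M"
  shows "left_module R (quotient_module M N)"
proof -
  interpret N: submodule N R M by fact
  have sg: "subgroup N (add_monoid M)" by (rule N.subgroup_axioms)
  have nor: "N \<lhd> add_monoid M"
    using M.a_comm_group sg by (simp add: comm_group.normal_iff_subgroup)
  have "abelian_subgroup N M"
    by (intro abelian_subgroupI3 additive_subgroup.intro sg M.abelian_group_axioms)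
  then have "comm_group (M A_Mod N)"
    by (rule abelian_subgroup.a_factorgroup_is_comm_group)
  then interpret Q: comm_group "M A_Mod N" .
  have eqs: "carrier (M A_Mod N) = carrier (quotient_module M N)" "one (M A_Mod N) = zero (quotient_module M N)"
    "mult (M A_Mod N) = add (quotient_module M N)"
    by (simp_all add: quotient_module_def A_FactGroup_def FactGroup_def A_RCOSETS_def set_add_def)
  have ag: "abelian_group (quotient_module M N)"
  proof (rule abelian_groupI)
    fix x assume "x \<in> carrier (quotient_module M N)"
    then show "\<exists>y\<in>carrier (quotient_module M N). y \<oplus>\<^bsub>quotient_module M N\<^esub> x = \<zero>\<^bsub>quotient_module M N\<^esub>"
      by (intro bexI[of _ "inv\<^bsub>M A_Mod N\<^esub> x"]) (simp_all add: eqs[symmetric] del: add_A_FactGroup)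
  qed (simp_all add: eqs[symmetric] Q.m_ac del: add_A_FactGroup)
  have cos: "\<exists>x\<in>carrier M. X = N +>\<^bsub>M\<^esub> x" if "X \<in> carrier (quotient_module M N)" for X
    using that by (auto simp: quotient_module_def A_RCOSETS_def')
  have mem: "N +>\<^bsub>M\<^esub> x \<in> carrier (quotient_module M N)" if "x \<in> carrier M" for x
    using that by (auto simp: quotient_module_def A_RCOSETS_def')
  have add: "(N +>\<^bsub>M\<^esub> x) \<oplus>\<^bsub>quotient_module M N\<^esub> (N +>\<^bsub>M\<^esub> y) = N +>\<^bsub>M\<^esub> (x \<oplus>\<^bsub>M\<^esub> y)"
    if "x \<in> carrier M" "y \<in> carrier M" for x y
    using normal.rcos_sum[OF nor] that by (simp add: quotient_module_def set_add_def a_r_coset_def)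
  note simps = mem add quotient_smult[OF assms] smult_l_distr smult_r_distr smult_assoc1
  show ?thesis
  proof (intro left_module.intro left_module_axioms.intro R.ring_axioms ag)
    fix a X assume a: "a \<in> carrier R" and X: "X \<in> carrier (quotient_module M N)"
    obtain x where x: "x \<in> carrier M" "X = N +>\<^bsub>M\<^esub> x"
      using cos[OF X] by blast
    show "a \<odot>\<^bsub>quotient_module M N\<^esub> X \<in> carrier (quotient_module M N)"
      using a x by (simp add: simps)
    show "(a \<oplus>\<^bsub>R\<^esub> b) \<odot>\<^bsub>quotient_module M N\<^esub> X =
        a \<odot>\<^bsub>quotient_module M N\<^esub> X \<oplus>\<^bsub>quotient_module M N\<^esub> b \<odot>\<^bsub>quotient_module M N\<^esub> X"
      and "(a \<otimes>\<^bsub>R\<^esub> b) \<odot>\<^bsub>quotient_module M N\<^esub> X =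
        a \<odot>\<^bsub>quotient_module M N\<^esub> (b \<odot>\<^bsub>quotient_module M N\<^esub> X)"
      if "b \<in> carrier R" for b
      using a x that by (simp_all add: simps)
    show "a \<odot>\<^bsub>quotient_module M N\<^esub> (X \<oplus>\<^bsub>quotient_module M N\<^esub> Y) =
        a \<odot>\<^bsub>quotient_module M N\<^esub> X \<oplus>\<^bsub>quotient_module M N\<^esub> a \<odot>\<^bsub>quotient_module M N\<^esub> Y"
      if Y: "Y \<in> carrier (quotient_module M N)" for Y
    proof -
      obtain y where "y \<in> carrier M" "Y = N +>\<^bsub>M\<^esub> y"
        using cos[OF Y] by blast
      then show ?thesis
        using a x by (simp add: simps)
    qed
  next
    fix X assume X: "X \<in> carrier (quotient_module M N)"
    obtain x where "x \<in> carrier M" "X = N +>\<^bsub>M\<^esub> x"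
      using cos[OF X] by blast
    then show "\<one>\<^bsub>R\<^esub> \<odot>\<^bsub>quotient_module M N\<^esub> X = X"
      by (simp add: simps)
  qed
qed

end

theory Submission
  imports Defs
begin

text \<open>
  A monomorphism \<open>f : M \<rightarrow> M/N\<close> yields the chain \<open>C\<^sub>0 = 0\<close>, \<open>C\<^sub>n\<^sub>+\<^sub>1/N = f(C\<^sub>n)\<close> of submodules of \<open>M\<close>;
  since \<open>f\<close> is injective, the chain can become stationary only if \<open>N = C\<^sub>1 = C\<^sub>0 = 0\<close>. So a
  compressible noetherian module is critically compressible. The remaining implications
  hold because every nonzero submodule of a noetherian module contains a nonzero cyclic uniform one:
  take \<open>A\<close> maximal among the submodules of \<open>N\<close> that meet some nonzero submodule of \<open>N\<close> in \<open>0\<close>;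
  any such complement of \<open>A\<close> is uniform.
\<close>

section \<open>Basic arithmetic and submodules of left modules\<close>

lemma (in left_module) smult_l_null [simp]:
  assumes "x \<in> carrier M"
  shows "\<zero>\<^bsub>R\<^esub> \<odot>\<^bsub>M\<^esub> x = \<zero>\<^bsub>M\<^esub>"
proof -
  have "\<zero>\<^bsub>R\<^esub> \<odot>\<^bsub>M\<^esub> x \<oplus>\<^bsub>M\<^esub> \<zero>\<^bsub>R\<^esub> \<odot>\<^bsub>M\<^esub> x = (\<zero>\<^bsub>R\<^esub> \<oplus>\<^bsub>R\<^esub> \<zero>\<^bsub>R\<^esub>) \<odot>\<^bsub>M\<^esub> x"
    using assms by (simp only: smult_l_distr R.zero_closed)
  then show ?thesis
    using assms by simp
qed

lemma (in left_module) smult_r_null [simp]: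
  assumes "a \<in> carrier R"
  shows "a \<odot>\<^bsub>M\<^esub> \<zero>\<^bsub>M\<^esub> = \<zero>\<^bsub>M\<^esub>"
proof -
  have "a \<odot>\<^bsub>M\<^esub> \<zero>\<^bsub>M\<^esub> \<oplus>\<^bsub>M\<^esub> a \<odot>\<^bsub>M\<^esub> \<zero>\<^bsub>M\<^esub> = a \<odot>\<^bsub>M\<^esub> (\<zero>\<^bsub>M\<^esub> \<oplus>\<^bsub>M\<^esub> \<zero>\<^bsub>M\<^esub>)"
    using assms by (simp only: smult_r_distr M.zero_closed)
  then show ?thesis
    using assms by simp
qed

lemma (in left_module) smult_minus_one:
  assumes "x \<in> carrier M"
  shows "(\<ominus>\<^bsub>R\<^esub> \<one>\<^bsub>R\<^esub>) \<odot>\<^bsub>M\<^esub> x = \<ominus>\<^bsub>M\<^esub> x"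
proof -
  have "(\<ominus>\<^bsub>R\<^esub> \<one>\<^bsub>R\<^esub>) \<odot>\<^bsub>M\<^esub> x \<oplus>\<^bsub>M\<^esub> \<one>\<^bsub>R\<^esub> \<odot>\<^bsub>M\<^esub> x = (\<ominus>\<^bsub>R\<^esub> \<one>\<^bsub>R\<^esub> \<oplus>\<^bsub>R\<^esub> \<one>\<^bsub>R\<^esub>) \<odot>\<^bsub>M\<^esub> x"
    using assms by (simp only: smult_l_distr R.one_closed R.a_inv_closed)
  also have "\<dots> = \<zero>\<^bsub>M\<^esub>"
    using assms by (simp add: R.l_neg)
  finally show ?thesis
    using assms M.minus_equality[of "(\<ominus>\<^bsub>R\<^esub> \<one>\<^bsub>R\<^esub>) \<odot>\<^bsub>M\<^esub> x" x] by simp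
qed

text \<open>Closure under negation comes for free, because \<open>-x\<close> is the scalar multiple
  of \<open>x\<close> by \<open>-1\<close>.\<close>

lemma (in left_module) left_submoduleI:
  assumes "H \<subseteq> carrier M" "\<zero>\<^bsub>M\<^esub> \<in> H"
    and "\<And>x y. \<lbrakk>x \<in> H; y \<in> H\<rbrakk> \<Longrightarrow> x \<oplus>\<^bsub>M\<^esub> y \<in> H"
    and "\<And>a x. \<lbrakk>a \<in> carrier R; x \<in> H\<rbrakk> \<Longrightarrow> a \<odot>\<^bsub>M\<^esub> x \<in> H"
  shows "submodule H R M"
proof (intro submodule.intro submodule_axioms.intro subgroup.intro)
  fix x assume x: "x \<in> H"
  have "\<ominus>\<^bsub>M\<^esub> x = (\<ominus>\<^bsub>R\<^esub> \<one>\<^bsub>R\<^esub>) \<odot>\<^bsub>M\<^esub> x"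
    using x assms(1) by (auto simp: smult_minus_one)
  then show "inv\<^bsub>add_monoid M\<^esub> x \<in> H"
    using x assms(4) by (simp add: a_inv_def)
qed (use assms in auto)

context left_module
begin

context
  fixes H
  assumes H: "submodule H R M"
begin

lemma left_submodule_subset: "H \<subseteq> carrier M"
  using subgroup.subset[OF submodule.axioms(1)[OF H]] by simp

lemma left_submodule_in_carrier: "x \<in> H \<Longrightarrow> x \<in> carrier M"
  using left_submodule_subset by blast

lemma left_submodule_zero: "\<zero>\<^bsub>M\<^esub> \<in> H"
  using subgroup.one_closed[OF submodule.axioms(1)[OF H]] by simp

lemma left_submodule_add: "\<lbrakk>x \<in> H; y \<in> H\<rbrakk> \<Longrightarrow> x \<oplus>\<^bsub>M\<^esub> y \<in> H"
  using subgroup.m_closed[OF submodule.axioms(1)[OF H]] by simp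

lemma left_submodule_smult: "\<lbrakk>a \<in> carrier R; x \<in> H\<rbrakk> \<Longrightarrow> a \<odot>\<^bsub>M\<^esub> x \<in> H"
  using submodule.smult_closed[OF H] by simp

lemma left_submodule_minus: "x \<in> H \<Longrightarrow> \<ominus>\<^bsub>M\<^esub> x \<in> H"
  using subgroup.m_inv_closed[OF submodule.axioms(1)[OF H]] by (simp add: a_inv_def)

lemma left_submodule_nonzero: "H \<noteq> {\<zero>\<^bsub>M\<^esub>} \<longleftrightarrow> (\<exists>x\<in>H. x \<noteq> \<zero>\<^bsub>M\<^esub>)"
  using left_submodule_zero by blast

end

text \<open>Lets all work on a submodule \<open>H\<close> take place inside \<open>M\<close>:
  operations, zero and scalar action are shared, so only the inclusion in \<open>H\<close> remains
  to be recorded.\<close>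

lemma submodule_restrict_iff:
  assumes H: "submodule H R M"
  shows "submodule A R (M\<lparr>carrier := H\<rparr>) \<longleftrightarrow> submodule A R M \<and> A \<subseteq> H"
proof
  assume A: "submodule A R (M\<lparr>carrier := H\<rparr>)"
  interpret MH: left_module R "M\<lparr>carrier := H\<rparr>"
    by (rule submodule_left_module[OF H])
  have "A \<subseteq> H"
    using MH.left_submodule_subset[OF A] by simp
  moreover have "submodule A R M"
  proof (rule left_submoduleI)
    show "A \<subseteq> carrier M"
      using \<open>A \<subseteq> H\<close> left_submodule_subset[OF H] by blast
  qed (use MH.left_submodule_zero[OF A] MH.left_submodule_add[OF A] MH.left_submodule_smult[OF A] in simp_all)
  ultimately show "submodule A R M \<and> A \<subseteq> H" by blast
next
  assume A: "submodule A R M \<and> A \<subseteq> H"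
  interpret MH: left_module R "M\<lparr>carrier := H\<rparr>"
    by (rule submodule_left_module[OF H])
  show "submodule A R (M\<lparr>carrier := H\<rparr>)"
  proof (rule MH.left_submoduleI)
    show "A \<subseteq> carrier (M\<lparr>carrier := H\<rparr>)" using A by simp
  qed (use A left_submodule_zero left_submodule_add left_submodule_smult in auto)
qed

text \<open>In this form uniformity visibly passes from \<open>H\<close> to any smaller submodule,
  as there are fewer pairs \<open>A\<close>, \<open>B\<close> to test.\<close>

lemma uniform_restrict_iff:
  assumes H: "submodule H R M"
  shows "uniform_module R (M\<lparr>carrier := H\<rparr>) \<longleftrightarrow>
    (\<forall>A B. submodule A R M \<and> submodule B R M \<and> A \<subseteq> H \<and> B \<subseteq> H \<and>
      A \<noteq> {\<zero>\<^bsub>M\<^esub>} \<and> B \<noteq> {\<zero>\<^bsub>M\<^esub>} \<longrightarrow> A \<inter> B \<noteq> {\<zero>\<^bsub>M\<^esub>})"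
  using submodule_left_module[OF H]
  by (auto simp: uniform_module_def uniform_module_axioms_def submodule_restrict_iff[OF H])

lemma zero_submodule: "submodule {\<zero>\<^bsub>M\<^esub>} R M"
  by (rule left_submoduleI) auto

lemma set_add_submodule:
  assumes A: "submodule A R M" and B: "submodule B R M"
  shows "submodule (A <+>\<^bsub>M\<^esub> B) R M"
proof (rule left_submoduleI)
  note in_carrier = left_submodule_in_carrier[OF A] left_submodule_in_carrier[OF B]
  have sum: "a \<oplus>\<^bsub>M\<^esub> b \<in> A <+>\<^bsub>M\<^esub> B" if "a \<in> A" "b \<in> B" for a b
    using that unfolding set_add_def' by blast
  show "A <+>\<^bsub>M\<^esub> B \<subseteq> carrier M"
    by (auto simp: set_add_def' in_carrier)
  show "\<zero>\<^bsub>M\<^esub> \<in> A <+>\<^bsub>M\<^esub> B"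
    using sum[OF left_submodule_zero[OF A] left_submodule_zero[OF B]] by simp
  fix x assume "x \<in> A <+>\<^bsub>M\<^esub> B"
  then obtain a b where x: "a \<in> A" "b \<in> B" "x = a \<oplus>\<^bsub>M\<^esub> b"
    by (auto simp: set_add_def')
  show "r \<odot>\<^bsub>M\<^esub> x \<in> A <+>\<^bsub>M\<^esub> B" if "r \<in> carrier R" for r
  proof -
    have "r \<odot>\<^bsub>M\<^esub> x = r \<odot>\<^bsub>M\<^esub> a \<oplus>\<^bsub>M\<^esub> r \<odot>\<^bsub>M\<^esub> b"
      using x that by (simp add: smult_r_distr in_carrier)
    then show ?thesis
      by (simp add: sum left_submodule_smult[OF A that x(1)] left_submodule_smult[OF B that x(2)])
  qed
  fix y assume "y \<in> A <+>\<^bsub>M\<^esub> B"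
  then obtain c d where y: "c \<in> A" "d \<in> B" "y = c \<oplus>\<^bsub>M\<^esub> d"
    by (auto simp: set_add_def')
  have "x \<oplus>\<^bsub>M\<^esub> y = (a \<oplus>\<^bsub>M\<^esub> c) \<oplus>\<^bsub>M\<^esub> (b \<oplus>\<^bsub>M\<^esub> d)"
    using x y by (simp add: M.a_ac in_carrier)
  then show "x \<oplus>\<^bsub>M\<^esub> y \<in> A <+>\<^bsub>M\<^esub> B"
    by (simp add: sum left_submodule_add[OF A x(1) y(1)] left_submodule_add[OF B x(2) y(2)])
qed

lemma cyclic_submodule:
  assumes x: "x \<in> carrier M"
  shows "submodule {r \<odot>\<^bsub>M\<^esub> x | r. r \<in> carrier R} R M"
proof (rule left_submoduleI)
  show "\<zero>\<^bsub>M\<^esub> \<in> {r \<odot>\<^bsub>M\<^esub> x | r. r \<in> carrier R}"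
    using x smult_l_null[OF x] R.zero_closed by force
qed (use x in \<open>auto simp flip: smult_l_distr smult_assoc1\<close>)

lemma module_mono_restrict_mono:
  assumes "A \<subseteq> B"
  shows "module_mono R L (M\<lparr>carrier := A\<rparr>) \<subseteq> module_mono R L (M\<lparr>carrier := B\<rparr>)"
  using assms by (auto simp: module_mono_def)

end

section \<open>Maximal, uniform and cyclic uniform submodules of noetherian modules\<close>

context noetherian_module
begin

text \<open>If no submodule with property \<open>P\<close> were maximal, each one would lie strictly
  inside another, and dependent choice would give a strictly ascending chain.\<close>

lemma maximal_submodule:
  assumes "submodule A R M" "P A"
  obtains C where "submodule C R M" "P C"
    "\<And>D. \<lbrakk>submodule D R M; P D; C \<subseteq> D\<rbrakk> \<Longrightarrow> D = C"
proof (rule ccontr)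
  note max = that
  assume no_max: "\<not> thesis"
  have step: "\<exists>D. (submodule D R M \<and> P D) \<and> C \<subset> D" if "submodule C R M \<and> P C" for C
  proof (rule ccontr)
    assume "\<nexists>D. (submodule D R M \<and> P D) \<and> C \<subset> D"
    then have "thesis"
      using \<open>submodule C R M \<and> P C\<close> by (intro max[of C]) auto
    with no_max show False ..
  qed
  have "\<exists>C. \<forall>n. (submodule (C n) R M \<and> P (C n)) \<and> C n \<subset> C (Suc n)"
  proof (rule dependent_nat_choice)
    show "\<exists>C. submodule C R M \<and> P C" using assms by blast
  qed (rule step)
  then obtain C where C: "\<And>n. submodule (C n) R M \<and> P (C n)" "\<And>n. C n \<subset> C (Suc n)"
    by blast
  then obtain m where m: "\<forall>n\<ge>m. C n = C m"
    using ascending_chain[of C] by blast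
  have "C (Suc m) = C m"
    by (rule m[rule_format]) simp
  then show False
    using C(2)[of m] by simp
qed

text \<open>Suppose a complement \<open>B\<close> of a maximal \<open>A\<close> contains nonzero
  \<open>C\<close> and \<open>D\<close> with zero intersection. Then \<open>D\<close> still meets
  \<open>A + C\<close> in zero, so maximality forces \<open>C\<close> into \<open>A\<close>,
  although \<open>C\<close> is nonzero and lies in \<open>B\<close>.\<close>

lemma uniform_submodule_exists:
  assumes N: "submodule N R M" "N \<noteq> {\<zero>\<^bsub>M\<^esub>}"
  obtains U where "submodule U R M" "U \<subseteq> N" "U \<noteq> {\<zero>\<^bsub>M\<^esub>}" "uniform_module R (M\<lparr>carrier := U\<rparr>)"
proof -
  \<comment> \<open>The complement \<open>B\<close> is quantified inside \<open>P\<close>, so it may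
    change with \<open>A\<close>: below, \<open>D\<close> takes over from \<open>B\<close> when
    \<open>A\<close> grows to \<open>A + C\<close>.\<close>
  define P where "P A \<longleftrightarrow> A \<subseteq> N \<and>
    (\<exists>B. submodule B R M \<and> B \<subseteq> N \<and> B \<noteq> {\<zero>\<^bsub>M\<^esub>} \<and> A \<inter> B = {\<zero>\<^bsub>M\<^esub>})" for A
  \<comment> \<open>The complement of zero is \<open>N\<close> itself, which is nonzero by
    hypothesis.\<close>
  have "P {\<zero>\<^bsub>M\<^esub>}"
    unfolding P_def using N left_submodule_zero[OF N(1)] by blast
  then obtain A where A: "submodule A R M" "P A"
    and max: "\<And>D. \<lbrakk>submodule D R M; P D; A \<subseteq> D\<rbrakk> \<Longrightarrow> D = A"
    using maximal_submodule[of "{\<zero>\<^bsub>M\<^esub>}" P, OF zero_submodule] by blast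
  obtain B where B: "submodule B R M" "B \<subseteq> N" "B \<noteq> {\<zero>\<^bsub>M\<^esub>}" "A \<inter> B = {\<zero>\<^bsub>M\<^esub>}" and "A \<subseteq> N"
    using A(2) unfolding P_def by blast
  have "C \<inter> D \<noteq> {\<zero>\<^bsub>M\<^esub>}"
    if C: "submodule C R M" "C \<subseteq> B" "C \<noteq> {\<zero>\<^bsub>M\<^esub>}" and D: "submodule D R M" "D \<subseteq> B" "D \<noteq> {\<zero>\<^bsub>M\<^esub>}"
    for C D
  proof
    assume CD: "C \<inter> D = {\<zero>\<^bsub>M\<^esub>}"
    let ?S = "A <+>\<^bsub>M\<^esub> C"
    note in_carrier = left_submodule_in_carrier[OF A(1)] left_submodule_in_carrier[OF C(1)]
    have S: "submodule ?S R M"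
      by (rule set_add_submodule[OF A(1) C(1)])
    \<comment> \<open>For \<open>x = a + c\<close> in \<open>D\<close>, the element
      \<open>a = x - c\<close> lies in \<open>B\<close>, since \<open>B\<close> contains both
      \<open>C\<close> and \<open>D\<close>. Hence \<open>a\<close> is in the zero intersection of
      \<open>A\<close> and \<open>B\<close>, and \<open>x = c\<close> lies in both \<open>C\<close>
      and \<open>D\<close>.\<close>
    have "x = \<zero>\<^bsub>M\<^esub>" if "x \<in> ?S" "x \<in> D" for x
    proof -
      obtain a c where ac: "a \<in> A" "c \<in> C" "x = a \<oplus>\<^bsub>M\<^esub> c"
        using \<open>x \<in> ?S\<close> by (auto simp: set_add_def')
      have "a = x \<oplus>\<^bsub>M\<^esub> \<ominus>\<^bsub>M\<^esub> c"
        using ac by (simp add: in_carrier M.a_assoc M.r_neg)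
      also have "\<dots> \<in> B"
        using ac \<open>x \<in> D\<close> C D left_submodule_add[OF B(1)] left_submodule_minus[OF B(1)] by blast
      finally have "a = \<zero>\<^bsub>M\<^esub>"
        using ac B by blast
      then have "x = c"
        using ac by (simp add: in_carrier)
      then show ?thesis
        using ac \<open>x \<in> D\<close> CD by blast
    qed
    then have "?S \<inter> D = {\<zero>\<^bsub>M\<^esub>}"
      using left_submodule_zero[OF S] left_submodule_zero[OF D(1)] by blast
    moreover have "?S \<subseteq> N"
      using left_submodule_add[OF N(1)] \<open>A \<subseteq> N\<close> C B by (force simp: set_add_def')
    ultimately have "P ?S"
      unfolding P_def using D B by blast
    moreover have "A \<subseteq> ?S"
    proof
      fix a assume "a \<in> A"
      then show "a \<in> ?S"
        using left_submodule_zero[OF C(1)] M.r_zero[of a] in_carrier unfolding set_add_def' by force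
    qed
    ultimately have "?S = A"
      using max S by blast
    moreover have "C \<subseteq> ?S"
    proof
      fix c assume "c \<in> C"
      then show "c \<in> ?S"
        using left_submodule_zero[OF A(1)] M.l_zero[of c] in_carrier unfolding set_add_def' by force
    qed
    \<comment> \<open>Now \<open>C\<close> lies in \<open>A\<close> as well as in \<open>B\<close>,
      so it is zero.\<close>
    ultimately show False
      using B C left_submodule_nonzero[OF C(1)] by blast
  qed
  then have "uniform_module R (M\<lparr>carrier := B\<rparr>)"
    by (simp add: uniform_restrict_iff[OF B(1)])
  with B that show ?thesis by blast
qed

text \<open>Any nonzero element of a uniform submodule generates a cyclic one, which inherits
  uniformity.\<close>

lemma cyclic_uniform_submodule_exists:
  assumes N: "submodule N R M" "N \<noteq> {\<zero>\<^bsub>M\<^esub>}"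
  obtains U where "submodule U R M" "U \<subseteq> N" "U \<noteq> {\<zero>\<^bsub>M\<^esub>}"
    "cyclic_module R (M\<lparr>carrier := U\<rparr>)" "uniform_module R (M\<lparr>carrier := U\<rparr>)"
proof -
  obtain V where V: "submodule V R M" "V \<subseteq> N" "V \<noteq> {\<zero>\<^bsub>M\<^esub>}" "uniform_module R (M\<lparr>carrier := V\<rparr>)"
    using uniform_submodule_exists[OF N] by blast
  obtain x where x: "x \<in> V" "x \<noteq> \<zero>\<^bsub>M\<^esub>"
    using left_submodule_nonzero[OF V(1)] V(3) by blast
  then have xM: "x \<in> carrier M"
    using left_submodule_in_carrier[OF V(1)] by blast
  define U where "U = {r \<odot>\<^bsub>M\<^esub> x | r. r \<in> carrier R}"
  have U: "submodule U R M"
    unfolding U_def by (rule cyclic_submodule[OF xM])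
  have UV: "U \<subseteq> V"
    unfolding U_def using left_submodule_smult[OF V(1)] x by blast
  have xU: "x \<in> U"
    unfolding U_def using smult_one[OF xM] R.one_closed by force
  have "uniform_module R (M\<lparr>carrier := U\<rparr>)"
    using V(4) UV unfolding uniform_restrict_iff[OF V(1)] uniform_restrict_iff[OF U]
    by (meson subset_trans)
  moreover have "cyclic_module R (M\<lparr>carrier := U\<rparr>)"
    using submodule_left_module[OF U] xU
    by (auto simp: cyclic_module_def cyclic_module_axioms_def U_def)
  ultimately show ?thesis
    using that U UV V(2) xU x(2) by blast
qed

section \<open>Noetherian modules do not embed in their proper quotients\<close>

text \<open>Elements of the quotient are cosets, hence subsets of \<open>M\<close>. So the preimage
  in \<open>M\<close> of the image of \<open>A\<close> under \<open>f\<close> is simply the union of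
  the sets \<open>f x\<close> for \<open>x\<close> in \<open>A\<close>, and no projection map has to
  be introduced.\<close>

lemma no_mono_into_proper_quotient:
  assumes N: "submodule N R M" "N \<noteq> {\<zero>\<^bsub>M\<^esub>}"
  shows "f \<notin> module_mono R M (quotient_module M N)"
proof
  let ?Q = "quotient_module M N"
  assume "f \<in> module_mono R M ?Q"
  then have closed: "\<And>x. x \<in> carrier M \<Longrightarrow> f x \<in> carrier ?Q"
    and add: "\<And>x y. \<lbrakk>x \<in> carrier M; y \<in> carrier M\<rbrakk> \<Longrightarrow> f (x \<oplus>\<^bsub>M\<^esub> y) = f x \<oplus>\<^bsub>?Q\<^esub> f y"
    and smult: "\<And>r x. \<lbrakk>r \<in> carrier R; x \<in> carrier M\<rbrakk> \<Longrightarrow> f (r \<odot>\<^bsub>M\<^esub> x) = r \<odot>\<^bsub>?Q\<^esub> f x"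
    and inj: "inj_on f (carrier M)"
    by (auto simp: module_mono_def)
  interpret Q: left_module R ?Q
    by (rule quotient_left_module[OF N(1)])
  have sg: "subgroup N (add_monoid M)"
    by (rule submodule.axioms(1)[OF N(1)])
  \<comment> \<open>The zero of the quotient is the set \<open>N\<close>, so the first nontrivial
    term of the chain will be \<open>N\<close>.\<close>
  have zero: "f \<zero>\<^bsub>M\<^esub> = N"
  proof -
    have "f \<zero>\<^bsub>M\<^esub> = \<zero>\<^bsub>R\<^esub> \<odot>\<^bsub>?Q\<^esub> f \<zero>\<^bsub>M\<^esub>"
      using smult[of "\<zero>\<^bsub>R\<^esub>" "\<zero>\<^bsub>M\<^esub>"] by simp
    also have "\<dots> = \<zero>\<^bsub>?Q\<^esub>"
      by (simp add: closed)
    finally show ?thesis by (simp add: quotient_module_def)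
  qed
  have coset: "f x \<in> rcosets\<^bsub>add_monoid M\<^esub> N" if "x \<in> carrier M" for x
    using closed[OF that] by (simp add: quotient_module_def A_RCOSETS_def)
  have coset_eq: "f x = N +>\<^bsub>M\<^esub> y" if "x \<in> carrier M" "y \<in> f x" for x y
    using coset[OF that(1)] that(2) M.add.repr_independence[OF _ _ sg]
    by (auto simp: RCOSETS_def a_r_coset_def)
  have in_carrier: "y \<in> carrier M" if "x \<in> carrier M" "y \<in> f x" for x y
    using coset[OF that(1)] that(2) M.add.rcosets_part_G[OF sg] by auto
  have self: "y \<in> N +>\<^bsub>M\<^esub> y" if "y \<in> carrier M" for y
    using M.add.rcos_self[OF _ sg] that by (simp add: a_r_coset_def)
  \<comment> \<open>Two cosets that share an element coincide, and injectivity of \<open>f\<close>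
    then identifies their arguments.\<close>
  have disjoint: "x = y" if "x \<in> carrier M" "y \<in> carrier M" "z \<in> f x" "z \<in> f y" for x y z
    using inj coset_eq that by (metis inj_onD)
  have nonempty: "\<exists>y. y \<in> f x" if "x \<in> carrier M" for x
    using subgroup.rcosets_non_empty[OF sg coset[OF that]] by blast
  have add_mem: "z \<oplus>\<^bsub>M\<^esub> w \<in> f (x \<oplus>\<^bsub>M\<^esub> y)"
    if "x \<in> carrier M" "y \<in> carrier M" "z \<in> f x" "w \<in> f y" for x y z w
    using that by (auto simp: add quotient_module_def set_add_def')
  have smult_mem: "r \<odot>\<^bsub>M\<^esub> z \<in> f (r \<odot>\<^bsub>M\<^esub> x)"
    if "r \<in> carrier R" "x \<in> carrier M" "z \<in> f x" for r x z
  proof -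
    have "f (r \<odot>\<^bsub>M\<^esub> x) = N +>\<^bsub>M\<^esub> (r \<odot>\<^bsub>M\<^esub> z)"
      by (simp only: smult[OF that(1,2)] coset_eq[OF that(2,3)]
          quotient_smult[OF N(1) that(1) in_carrier[OF that(2,3)]])
    then show ?thesis
      using self in_carrier that by simp
  qed
  \<comment> \<open>Starting from zero, each step takes the preimage in \<open>M\<close> of the
    image under \<open>f\<close>.\<close>
  define C where "C n = ((\<lambda>A. \<Union>(f ` A)) ^^ n) {\<zero>\<^bsub>M\<^esub>}" for n
  have C_Suc: "C (Suc n) = \<Union>(f ` C n)" for n
    by (simp add: C_def)
  have C: "submodule (C n) R M" for n
  proof (induction n)
    case 0
    then show ?case by (simp add: C_def zero_submodule)
  next
    case (Suc n)
    note sub = left_submodule_in_carrier[OF Suc]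
    show ?case
      unfolding C_Suc
    proof (rule left_submoduleI)
      show "\<Union>(f ` C n) \<subseteq> carrier M"
        using in_carrier sub by blast
      show "\<zero>\<^bsub>M\<^esub> \<in> \<Union>(f ` C n)"
        using zero left_submodule_zero[OF N(1)] left_submodule_zero[OF Suc] by blast
    next
      fix z w assume "z \<in> \<Union>(f ` C n)" "w \<in> \<Union>(f ` C n)"
      then obtain x y where xy: "x \<in> C n" "y \<in> C n" "z \<in> f x" "w \<in> f y" by blast
      show "z \<oplus>\<^bsub>M\<^esub> w \<in> \<Union>(f ` C n)"
        using left_submodule_add[OF Suc xy(1,2)] by (rule UN_I) (intro add_mem sub xy)
    next
      fix r z assume r: "r \<in> carrier R" and "z \<in> \<Union>(f ` C n)"
      then obtain x where x: "x \<in> C n" "z \<in> f x" by blast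
      show "r \<odot>\<^bsub>M\<^esub> z \<in> \<Union>(f ` C n)"
        using left_submodule_smult[OF Suc r x(1)] by (rule UN_I) (intro smult_mem sub r x)
    qed
  qed
  \<comment> \<open>Only the first inclusion needs an argument; the others follow because the
    operation iterated is monotone.\<close>
  have "C n \<subseteq> C (Suc n)" for n
  proof (induction n)
    case 0
    have "C 0 = {\<zero>\<^bsub>M\<^esub>}" by (simp add: C_def)
    then show ?case using left_submodule_zero[OF C, of "Suc 0"] by simp
  next
    case (Suc n)
    then show ?case unfolding C_Suc by blast
  qed
  then obtain m where m: "\<forall>n\<ge>m. C n = C m"
    using ascending_chain[of C] C by blast
  have "C (Suc m) = C m"
    by (rule m[rule_format]) simp
  \<comment> \<open>Injectivity lets equality of consecutive terms descend along the chain, down to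
    \<open>C 1 = C 0\<close>, which says that \<open>N\<close> is zero.\<close>
  moreover have "C (Suc n) \<noteq> C n" for n
  proof (induction n)
    case 0
    then show ?case
      using zero N(2) by (simp add: C_def)
  next
    case (Suc n)
    have "C (Suc n) = C n" if eq: "C (Suc (Suc n)) = C (Suc n)"
    proof -
      \<comment> \<open>Any \<open>z\<close> in the nonempty set \<open>f x\<close> lies in
        \<open>C (Suc l)\<close>, hence in \<open>f y\<close> for some \<open>y\<close> in
        \<open>C k\<close>, and disjointness gives \<open>x = y\<close>. Used with
        (\<open>l\<close>, \<open>k\<close>) equal to (\<open>Suc n\<close>, \<open>n\<close>) and
        to (\<open>n\<close>, \<open>Suc n\<close>), this yields both inclusions.\<close>
      have *: "x \<in> C k" if "x \<in> C l" "C (Suc l) \<subseteq> C (Suc k)" for x k l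
      proof -
        have x: "x \<in> carrier M"
          by (rule left_submodule_in_carrier[OF C that(1)])
        then obtain z where z: "z \<in> f x" using nonempty by blast
        then have "z \<in> \<Union>(f ` C k)"
          using that unfolding C_Suc by blast
        then obtain y where y: "y \<in> C k" "z \<in> f y" by blast
        have "x = y"
          by (rule disjoint[OF x left_submodule_in_carrier[OF C y(1)] z y(2)])
        with y show ?thesis by simp
      qed
      show ?thesis
        using * eq by blast
    qed
    with Suc show ?case by blast
  qed
  ultimately show False by blast
qed

end

section \<open>The equivalences, first for noetherian modules and then for the ring\<close>

lemma compressible_iff_critically_compressible:
  assumes "noetherian_module R M"
  shows "compressible_module R M \<longleftrightarrow> critically_compressible_module R M"
  using noetherian_module.no_mono_into_proper_quotient[OF assms]
  by (auto simp: critically_compressible_module_def critically_compressible_module_axioms_def)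

text \<open>A monomorphism into a cyclic uniform submodule of \<open>N\<close> is also one into
  \<open>N\<close>, so testing these small targets suffices.\<close>

lemma compressible_if_mono_into_cyclic_uniform:
  assumes "noetherian_module R M" "carrier M \<noteq> {\<zero>\<^bsub>M\<^esub>}"
    and mono: "\<And>U. \<lbrakk>submodule U R M; U \<noteq> {\<zero>\<^bsub>M\<^esub>}; cyclic_module R (M\<lparr>carrier := U\<rparr>);
      uniform_module R (M\<lparr>carrier := U\<rparr>)\<rbrakk> \<Longrightarrow> \<exists>f. f \<in> module_mono R M (M\<lparr>carrier := U\<rparr>)"
  shows "compressible_module R M"
proof -
  interpret noetherian_module R M by fact
  show ?thesis
  proof
    fix N assume "submodule N R M" "N \<noteq> {\<zero>\<^bsub>M\<^esub>}"
    then obtain U where U: "submodule U R M" "U \<subseteq> N" "U \<noteq> {\<zero>\<^bsub>M\<^esub>}"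
      "cyclic_module R (M\<lparr>carrier := U\<rparr>)" "uniform_module R (M\<lparr>carrier := U\<rparr>)"
      using cyclic_uniform_submodule_exists by blast
    then show "\<exists>f. f \<in> module_mono R M (M\<lparr>carrier := N\<rparr>)"
      using mono module_mono_restrict_mono by blast
  qed (fact assms(2))
qed

theorem proposition2p13:
  fixes R :: "('a, 'm) ring_scheme"
  assumes "left_right_noetherian_ring R"
  shows "(compressible_module R (regular_module R) \<longleftrightarrow>
            critically_compressible_module R (regular_module R)) \<and>
         (compressible_module R (regular_module R) \<longleftrightarrow>
            (\<forall>U. submodule U R (regular_module R) \<and> U \<noteq> {\<zero>\<^bsub>R\<^esub>} \<and>
                 uniform_module R ((regular_module R)\<lparr>carrier := U\<rparr>) \<longrightarrow>
               (\<exists>f. f \<in> module_mono R (regular_module R) ((regular_module R)\<lparr>carrier := U\<rparr>)))) \<and>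
         (compressible_module R (regular_module R) \<longleftrightarrow>
            (\<forall>U. submodule U R (regular_module R) \<and> U \<noteq> {\<zero>\<^bsub>R\<^esub>} \<and>
                 cyclic_module R ((regular_module R)\<lparr>carrier := U\<rparr>) \<and>
                 uniform_module R ((regular_module R)\<lparr>carrier := U\<rparr>) \<longrightarrow>
               (\<exists>f. f \<in> module_mono R (regular_module R) ((regular_module R)\<lparr>carrier := U\<rparr>))))"
proof -
  let ?M = "regular_module R"
  interpret left_right_noetherian_ring R by fact
  have zero: "\<zero>\<^bsub>?M\<^esub> = \<zero>\<^bsub>R\<^esub>"
    by (simp add: regular_module_def)
  \<comment> \<open>The element \<open>1\<close> witnesses that the regular module is
    nonzero.\<close>
  have nonzero: "carrier ?M \<noteq> {\<zero>\<^bsub>?M\<^esub>}"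
    using one_not_zero one_closed by (auto simp: regular_module_def)
  have into_submodule: "\<exists>f. f \<in> module_mono R ?M (?M\<lparr>carrier := U\<rparr>)"
    if "compressible_module R ?M" "submodule U R ?M" "U \<noteq> {\<zero>\<^bsub>R\<^esub>}" for U
    using compressible_module.mono_into_submodule[OF that(1,2)] that(3) zero by simp
  note from_cyclic = compressible_if_mono_into_cyclic_uniform[OF left_noetherian nonzero, unfolded zero]
  show ?thesis
    \<comment> \<open>Compressibility gives (iii) by restriction to uniform \<open>U\<close>, and
      (iii) gives (iv) by further restriction to cyclic \<open>U\<close>; \<open>from_cyclic\<close>
      leads from (iv) back to (i).\<close>
    using compressible_iff_critically_compressible[OF left_noetherian] into_submodule from_cyclic
    by (intro conjI; blast)
qed

end
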